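(* Let $A\subset\mathbb{R}$ be an open invex subset with respect to $\eta:A\times A\to\mathbb{R}$ and let $a,b\in A$ with $a<a+\eta(b,a)$. Suppose that $f:A\to\mathbb{R}$ is a differentiable function such that $|f'|^{q}$ is preinvex with respect to $\eta$ on $[a,a+\eta(b,a)]$ for some fixed $q>1$. If $f'$ is integrable on $[a,a+\eta(b,a)]$ and $\eta$ satisfies condition C, then for each $x\in[a,a+\eta(b,a)]$ $$\left|f(x)-\frac{1}{\eta(b,a)}\int_{a}^{a+\eta(b,a)}f(u)\,du\right|\le\left(\frac{1}{p+1}\right)^{\frac1p}\left\{\frac{(x-a)^{2}}{\eta(b,a)}\left(\frac{|f'(a)|^{q}+|f'(x)|^{q}}{2}\right)^{\frac1q}+\frac{(a+\eta(b,a)-x)^{2}}{\eta(b,a)}\left(\frac{|f'(a+\eta(b,a))|^{q}+|f'(x)|^{q}}{2}\right)^{\frac1q}\right\},$$ where $\frac1p+\frac1q=1$.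
   Context: A set $A\subset\mathbb{R}$ is called invex with respect to $\eta:A\times A\to\mathbb{R}$ if $x+t\eta(y,x)\in A$ for all $x,y\in A$ and $t\in[0,1]$. A function $g$ is called preinvex with respect to $\eta$ on a set $S\subset A$ that is invex with respect to $\eta$ if $g(x+t\eta(y,x))\le(1-t)g(x)+t\,g(y)$ for all $x,y\in S$ and $t\in[0,1]$. Condition C on $\eta$ (for $A$ open and invex with respect to $\eta$): for any $x,y\in A$ and any $t\in[0,1]$, $\eta(y,y+t\eta(x,y))=-t\,\eta(x,y)$ and $\eta(x,y+t\eta(x,y))=(1-t)\,\eta(x,y)$. Under condition C one has $\eta(y+t_2\eta(x,y),y+t_1\eta(x,y))=(t_2-t_1)\eta(x,y)$ for $x,y\in A$, $t_1,t_2\in[0,1]$, so the interval $[a,a+\eta(b,a)]$ is invex with respect to $\eta$. *)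

theory Defs
  imports "HOL-Analysis.Analysis"
begin

text \<open>The map \<open>\<eta> : A \<times> A \<rightarrow> \<real>\<close> is a total curried function; its values are used only at points of \<open>A\<close>.\<close>

definition invex :: "(real \<Rightarrow> real \<Rightarrow> real) \<Rightarrow> real set \<Rightarrow> bool" where
  "invex \<eta> A \<longleftrightarrow> (\<forall>x\<in>A. \<forall>y\<in>A. \<forall>t\<in>{0..1}. x + t * \<eta> y x \<in> A)"

text \<open>As in \<open>convex_on\<close>, the requirement that the domain is invex is part of the definition.\<close>

definition preinvex_on :: "(real \<Rightarrow> real \<Rightarrow> real) \<Rightarrow> real set \<Rightarrow> (real \<Rightarrow> real) \<Rightarrow> bool" where
  "preinvex_on \<eta> S g \<longleftrightarrow> invex \<eta> S \<and>
     (\<forall>x\<in>S. \<forall>y\<in>S. \<forall>t\<in>{0..1}. g (x + t * \<eta> y x) \<le> (1 - t) * g x + t * g y)"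

definition condition_C :: "(real \<Rightarrow> real \<Rightarrow> real) \<Rightarrow> real set \<Rightarrow> bool" where
  "condition_C \<eta> A \<longleftrightarrow> (\<forall>x\<in>A. \<forall>y\<in>A. \<forall>t\<in>{0..1}.
     \<eta> y (y + t * \<eta> x y) = - t * \<eta> x y \<and>
     \<eta> x (y + t * \<eta> x y) = (1 - t) * \<eta> x y)"

end

theory Submission
  imports Defs
begin

text \<open>Condition C forces \<open>\<eta> z w = z - w\<close> on \<open>[a, a + \<eta> b a]\<close>, so that \<open>\<bar>f'\<bar>\<^sup>q\<close> is convex there.
  With \<open>F' = f\<close> and \<open>e\<close> an endpoint of the interval, the function \<open>u \<mapsto> (u - e) f(u) - F(u)\<close> has
  derivative \<open>(u - e) f'(u)\<close>. After rescaling \<open>[e, x]\<close> to the unit interval, Young's inequality,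
  with weights chosen so that its integrated form is sharp (this replaces Hoelder's inequality),
  bounds this derivative pointwise by a function with an explicit antiderivative. Adding
  the bounds for the two endpoints gives the theorem.\<close>

text \<open>Condition C evaluates \<eta> from a base point \<open>v\<close> to a point reached from
  \<open>v\<close> along some \<open>\<eta> u v\<close>. Take \<open>v = z t2\<close> as base:
  \<open>z t1\<close> is reached from it by moving towards \<open>y\<close> when
  \<open>t1 < t2\<close> and towards \<open>x\<close> when \<open>t1 > t2\<close>.\<close>

lemma condition_C_eta_segment:
  assumes inv: "invex \<eta> A" and C: "condition_C \<eta> A" and A: "x \<in> A" "y \<in> A"
    and t: "t1 \<in> {0..1}" "t2 \<in> {0..1}"
  shows "\<eta> (y + t2 * \<eta> x y) (y + t1 * \<eta> x y) = (t2 - t1) * \<eta> x y"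
proof -
  define z where "z r = y + r * \<eta> x y" for r
  have zA: "z r \<in> A" if "r \<in> {0..1}" for r
    using inv A that by (auto simp: invex_def z_def)
  have Cx: "\<eta> x (z r) = (1 - r) * \<eta> x y" and Cy: "\<eta> y (z r) = - r * \<eta> x y" if "r \<in> {0..1}" for r
    using C A that by (auto simp: condition_C_def z_def)
  have C1: "\<eta> v (v + s * \<eta> u v) = - s * \<eta> u v" if "u \<in> A" "v \<in> A" "s \<in> {0..1}" for u v s
    using C that unfolding condition_C_def by blast
  have "\<eta> (z t2) (z t1) = (t2 - t1) * \<eta> x y"
  proof (cases t1 t2 rule: linorder_cases)
    case less
    \<comment> \<open>By \<open>Cy\<close>, moving from \<open>z t2\<close> along
      \<open>\<eta> y (z t2)\<close> by the fraction \<open>s\<close> lowers the parameter by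
      \<open>s * t2\<close>; this \<open>s\<close> makes it land on \<open>t1\<close>. Here
      \<open>t2 > t1 \<ge> 0\<close>, so the division is legitimate.\<close>
    define s where "s = (t2 - t1) / t2"
    have s: "s \<in> {0..1}" "s * t2 = t2 - t1" using less t by (auto simp: s_def field_simps)
    have "z t2 + s * \<eta> y (z t2) = y + (t2 - s * t2) * \<eta> x y"
      unfolding Cy[OF t(2)] by (simp add: z_def algebra_simps)
    hence "z t1 = z t2 + s * \<eta> y (z t2)" using s by (simp add: z_def)
    hence "\<eta> (z t2) (z t1) = s * t2 * \<eta> x y"
      using C1[OF A(2) zA[OF t(2)] s(1)] Cy[OF t(2)] by simp
    thus ?thesis using s by simp
  next
    case equal
    show ?thesis using C1[OF zA[OF t(1)] zA[OF t(1)], of 0] equal by simp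
  next
    case greater
    \<comment> \<open>Mirror image: the move towards \<open>x\<close> raises the parameter by
      \<open>s * (1 - t2)\<close>, and \<open>t2 < t1 \<le> 1\<close>.\<close>
    define s where "s = (t1 - t2) / (1 - t2)"
    have s: "s \<in> {0..1}" "s * (1 - t2) = t1 - t2" using greater t by (auto simp: s_def field_simps)
    have "z t2 + s * \<eta> x (z t2) = y + (t2 + s * (1 - t2)) * \<eta> x y"
      unfolding Cx[OF t(2)] by (simp add: z_def algebra_simps)
    hence "z t1 = z t2 + s * \<eta> x (z t2)" using s by (simp add: z_def)
    hence "\<eta> (z t2) (z t1) = - (s * (1 - t2)) * \<eta> x y"
      using C1[OF A(1) zA[OF t(2)] s(1)] Cx[OF t(2)] by simp
    thus ?thesis using s by simp
  qed
  thus ?thesis by (simp add: z_def)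
qed

lemma condition_C_eta_diff:
  assumes "invex \<eta> A" "condition_C \<eta> A" "a \<in> A" "b \<in> A" "0 < \<eta> b a"
    and z: "z \<in> {a..a + \<eta> b a}" and w: "w \<in> {a..a + \<eta> b a}"
  shows "\<eta> z w = z - w"
proof -
  have 1: "(r - a) / \<eta> b a \<in> {0..1}" "a + (r - a) / \<eta> b a * \<eta> b a = r"
    if "r \<in> {a..a + \<eta> b a}" for r
    using that assms(5) by (auto simp: field_simps)
  have "\<eta> (a + (z - a) / \<eta> b a * \<eta> b a) (a + (w - a) / \<eta> b a * \<eta> b a)
      = ((z - a) / \<eta> b a - (w - a) / \<eta> b a) * \<eta> b a"
    by (rule condition_C_eta_segment[OF assms(1,2,4,3) 1(1)[OF w] 1(1)[OF z]])
  thus ?thesis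
    unfolding 1(2)[OF z] 1(2)[OF w] using assms(5) by (simp flip: diff_divide_distrib)
qed

text \<open>Young's inequality for \<open>s / k\<close> and \<open>g / m\<close>, multiplied by
  \<open>k * m\<close>. Here \<open>k\<close> is the p-norm of the identity on [0,1], since
  \<open>s powr p\<close> has integral 1 / (p + 1) there. If \<open>N\<close> is the integral of
  \<open>g powr q\<close>, the right-hand side integrates to
  \<open>k * m * (1 / p + 1 / q) = k * m\<close>, which is exactly the Hoelder bound.\<close>

lemma weighted_Young:
  fixes p q s g N :: real
  assumes pq: "p > 1" "q > 1" "1 / p + 1 / q = 1" and "s \<ge> 0" "g \<ge> 0" "N > 0"
  shows "s * g \<le> (1 / (p + 1)) powr (1 / p) * N powr (1 / q) *
    ((p + 1) * s powr p / p + g powr q / (N * q))"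
proof -
  define k where "k = (1 / (p + 1)) powr (1 / p)"
  define m where "m = N powr (1 / q)"
  have km: "k > 0" "m > 0" using assms by (auto simp: k_def m_def)
  have "s / k * (g / m) \<le> (s / k) powr p / p + (g / m) powr q / q"
    by (intro Youngs_inequality) (use assms km in auto)
  moreover have "(s / k) powr p = (p + 1) * s powr p"
    using assms km by (simp add: powr_divide powr_mult k_def powr_powr)
  moreover have "(g / m) powr q = g powr q / N"
    using assms km by (simp add: powr_divide m_def powr_powr)
  ultimately have "s / k * (g / m) \<le> (p + 1) * s powr p / p + g powr q / (N * q)"
    by simp
  from mult_left_mono[OF this, of "k * m"] show ?thesis
    using km by (simp add: k_def m_def)
qed

text \<open>Both \<open>B - f\<close> and \<open>B + f\<close> have nonnegative derivative, hence
  are nondecreasing. Derivatives are taken only at interior points, so that \<open>B\<close> may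
  contain a real power of the variable on an interval starting at 0.\<close>

lemma abs_increment_le_DERIV_bound:
  fixes f B :: "real \<Rightarrow> real"
  assumes "l \<le> r" "continuous_on {l..r} f" "continuous_on {l..r} B"
    and f: "\<And>t. l < t \<Longrightarrow> t < r \<Longrightarrow> (f has_real_derivative f' t) (at t)"
    and B: "\<And>t. l < t \<Longrightarrow> t < r \<Longrightarrow> (B has_real_derivative B' t) (at t)"
    and le: "\<And>t. l < t \<Longrightarrow> t < r \<Longrightarrow> \<bar>f' t\<bar> \<le> B' t"
  shows "\<bar>f r - f l\<bar> \<le> B r - B l"
proof -
  have "B l - f l \<le> B r - f r"
  proof (rule DERIV_nonneg_imp_increasing_open[OF assms(1)])
    fix t assume "l < t" "t < r"
    thus "\<exists>y. ((\<lambda>u. B u - f u) has_real_derivative y) (at t) \<and> 0 \<le> y"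
      using DERIV_diff[OF B f, of t] le[of t] by force
  qed (intro continuous_intros assms)
  moreover have "B l + f l \<le> B r + f r"
  proof (rule DERIV_nonneg_imp_increasing_open[OF assms(1)])
    fix t assume "l < t" "t < r"
    thus "\<exists>y. ((\<lambda>u. B u + f u) has_real_derivative y) (at t) \<and> 0 \<le> y"
      using DERIV_add[OF B f, of t] le[of t] by force
  qed (intro continuous_intros assms)
  ultimately show ?thesis by linarith
qed

lemma unit_interval_increment_bound:
  fixes \<Phi> \<Phi>' g :: "real \<Rightarrow> real"
  assumes pq: "p > 1" "q > 1" "1 / p + 1 / q = 1" and PQ: "P \<ge> 0" "Q \<ge> 0"
    and deriv: "\<And>s. s \<in> {0..1} \<Longrightarrow> (\<Phi> has_real_derivative \<Phi>' s) (at s within {0..1})"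
    and bound: "\<And>s. s \<in> {0..1} \<Longrightarrow> \<bar>\<Phi>' s\<bar> \<le> C * (s * g s)"
    and g: "\<And>s. s \<in> {0..1} \<Longrightarrow> 0 \<le> g s"
    and conv: "\<And>s. s \<in> {0..1} \<Longrightarrow> g s powr q \<le> (1 - s) * P + s * Q"
    and C: "C \<ge> 0"
  shows "\<bar>\<Phi> 1 - \<Phi> 0\<bar> \<le> C * ((1 / (p + 1)) powr (1 / p) * ((P + Q) / 2) powr (1 / q))"
proof -
  have cont: "continuous_on {0..1} \<Phi>"
    using deriv by (rule DERIV_continuous_on)
  have deriv': "(\<Phi> has_real_derivative \<Phi>' s) (at s)" if "0 < s" "s < 1" for s
    using deriv[of s] that by (simp add: at_within_Icc_at)
  show ?thesis
  \<comment> \<open>The weighted Young inequality divides by the mean of \<open>P\<close> and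
    \<open>Q\<close>. If that mean is 0, then \<open>g\<close> vanishes and \<open>\<Phi>\<close> is
    constant.\<close>
  proof (cases "P + Q = 0")
    case True
    hence "P = 0" "Q = 0" using PQ by auto
    hence "g s = 0" if "s \<in> {0..1}" for s using conv[OF that] by simp
    hence z: "\<bar>\<Phi>' s\<bar> \<le> 0" if "0 < s" "s < 1" for s using bound[of s] that by simp
    have "\<bar>\<Phi> 1 - \<Phi> 0\<bar> \<le> (\<lambda>_. 0) 1 - (\<lambda>_. 0) (0 :: real)"
      by (rule abs_increment_le_DERIV_bound[where B = "\<lambda>_. 0" and B' = "\<lambda>_. 0",
            OF _ cont _ deriv' _ z]) simp_all
    thus ?thesis using True by simp
  next
    case False
    \<comment> \<open>The integral over [0,1] of the linear majorant
      \<open>(1 - s) * P + s * Q\<close> of \<open>g s powr q\<close>.\<close>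
    define N where "N = (P + Q) / 2"
    have N: "N > 0" using False PQ by (simp add: N_def)
    define k where "k = (1 / (p + 1)) powr (1 / p) * N powr (1 / q)"
    have k: "k \<ge> 0" by (simp add: k_def)
    \<comment> \<open>\<open>B'\<close> is the Young bound with \<open>g s powr q\<close> replaced
      by its linear majorant, and \<open>B\<close> is its antiderivative.\<close>
    define B where "B s = C * k * (s powr (p + 1) / p + (P * s + (Q - P) * s\<^sup>2 / 2) / (N * q))" for s
    define B' where "B' s = C * k * ((p + 1) * s powr p / p + ((1 - s) * P + s * Q) / (N * q))" for s
    have "\<bar>\<Phi> 1 - \<Phi> 0\<bar> \<le> B 1 - B 0"
    proof (rule abs_increment_le_DERIV_bound[OF _ cont _ deriv'])
      \<comment> \<open>At 0 the continuity of the power depends on its exponent being positive, so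
        it is proved separately and kept folded as \<open>w\<close>.\<close>
      define w where "w s = s powr (p + 1)" for s :: real
      have "continuous_on {0..1} w"
        unfolding w_def by (rule continuous_on_powr') (use pq in auto)
      thus "continuous_on {0..1} B"
        unfolding B_def w_def[symmetric] using pq N by (intro continuous_intros) auto
      show "(B has_real_derivative B' s) (at s)" if "0 < s" "s < 1" for s
      proof -
        have 1: "((\<lambda>s. s powr (p + 1)) has_real_derivative (p + 1) * s powr p) (at s)"
          using has_real_derivative_powr[OF that(1), of "p + 1"] by simp
        have 2: "((\<lambda>s. P * s + (Q - P) * s\<^sup>2 / 2) has_real_derivative (1 - s) * P + s * Q) (at s)"
          by (auto intro!: derivative_eq_intros simp: field_simps)
        show ?thesis
          unfolding B_def B'_def by (intro DERIV_cmult DERIV_add DERIV_cdivide 1 2)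
      qed
      show "\<bar>\<Phi>' s\<bar> \<le> B' s" if s: "0 < s" "s < 1" for s
      proof -
        have "s * g s \<le> k * ((p + 1) * s powr p / p + g s powr q / (N * q))"
          unfolding k_def by (rule weighted_Young) (use pq s g[of s] N in auto)
        also have "\<dots> \<le> k * ((p + 1) * s powr p / p + ((1 - s) * P + s * Q) / (N * q))"
          by (intro mult_left_mono add_left_mono divide_right_mono conv k) (use s N pq in auto)
        finally have "C * (s * g s) \<le> B' s"
          using C unfolding B'_def by (simp add: mult.assoc mult_left_mono)
        thus ?thesis using bound[of s] s by simp
      qed
    qed auto
    \<comment> \<open>The weights pay off here: the two summands contribute 1 / p and 1 / q, which
      add up to 1.\<close>
    also have "B 1 - B 0 = C * k * (1 / p + N / (N * q))"
      using pq by (simp add: B_def N_def field_simps)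
    also have "\<dots> = C * k" using N pq by simp
    finally show ?thesis by (simp add: k_def N_def)
  qed
qed

text \<open>On the path \<open>l\<close> from \<open>e\<close> to \<open>x\<close>, the factor
  \<open>l s - e\<close> equals \<open>s * (x - e)\<close> and the chain rule supplies a second
  \<open>x - e\<close>. The resulting square makes the estimate independent of the side of
  \<open>x\<close> on which \<open>e\<close> lies, so one lemma serves both endpoints.\<close>

lemma endpoint_bound:
  fixes f f' F :: "real \<Rightarrow> real"
  assumes pq: "p > 1" "q > 1" "1 / p + 1 / q = 1"
    and S: "convex S" "e \<in> S" "x \<in> S"
    and f: "\<And>u. u \<in> S \<Longrightarrow> (f has_real_derivative f' u) (at u within S)"
    and F: "\<And>u. u \<in> S \<Longrightarrow> (F has_real_derivative f u) (at u within S)"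
    and conv: "convex_on S (\<lambda>u. \<bar>f' u\<bar> powr q)"
  shows "\<bar>(x - e) * f x - (F x - F e)\<bar> \<le> (x - e)\<^sup>2 *
    ((1 / (p + 1)) powr (1 / p) * ((\<bar>f' e\<bar> powr q + \<bar>f' x\<bar> powr q) / 2) powr (1 / q))"
proof -
  define l where "l s = e + s * (x - e)" for s
  have l_conv: "l s = (1 - s) *\<^sub>R e + s *\<^sub>R x" for s
    by (simp add: l_def algebra_simps)
  have lS: "l s \<in> S" if "s \<in> {0..1}" for s
    unfolding l_conv using S that by (intro convexD_alt) auto
  have sub: "l ` {0..1} \<subseteq> S" using lS by auto
  define G where "G u = (u - e) * f u - F u" for u
  have G: "(G has_real_derivative (u - e) * f' u) (at u within S)" if "u \<in> S" for u
    unfolding G_def by (rule derivative_eq_intros f[OF that] F[OF that] refl | simp)+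
  have G': "((\<lambda>s. G (l s)) has_real_derivative (l s - e) * f' (l s) * (x - e)) (at s within {0..1})"
    if "s \<in> {0..1}" for s
  proof -
    have "(l has_real_derivative (x - e)) (at s within {0..1})"
      unfolding l_def by (auto intro!: derivative_eq_intros)
    from DERIV_image_chain[OF DERIV_subset[OF G[OF lS[OF that]] sub] this]
    show ?thesis by (simp add: o_def)
  qed
  have "\<bar>G (l 1) - G (l 0)\<bar> \<le> (x - e)\<^sup>2 *
    ((1 / (p + 1)) powr (1 / p) * ((\<bar>f' e\<bar> powr q + \<bar>f' x\<bar> powr q) / 2) powr (1 / q))"
  proof (rule unit_interval_increment_bound[OF pq _ _ G', where g = "\<lambda>s. \<bar>f' (l s)\<bar>"])
    show "\<bar>(l s - e) * f' (l s) * (x - e)\<bar> \<le> (x - e)\<^sup>2 * (s * \<bar>f' (l s)\<bar>)" if "s \<in> {0..1}" for s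
    proof -
      have eq: "(l s - e) * f' (l s) * (x - e) = (x - e)\<^sup>2 * (s * f' (l s))"
        by (simp add: l_def power2_eq_square)
      show ?thesis unfolding eq using that by (simp add: abs_mult)
    qed
    show "\<bar>f' (l s)\<bar> powr q \<le> (1 - s) * \<bar>f' e\<bar> powr q + s * \<bar>f' x\<bar> powr q" if "s \<in> {0..1}" for s
      unfolding l_conv using convex_onD[OF conv, of s e x] S that by simp
  qed auto
  thus ?thesis by (simp add: G_def l_def algebra_simps)
qed

theorem theorem2p4:
  fixes A :: "real set" and \<eta> :: "real \<Rightarrow> real \<Rightarrow> real"
    and f f' :: "real \<Rightarrow> real" and a b p q x :: real
  assumes "open A" and "invex \<eta> A"
    and "a \<in> A" and "b \<in> A" and "a < a + \<eta> b a"
    and "\<And>u. u \<in> A \<Longrightarrow> (f has_real_derivative f' u) (at u)"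
    and "q > 1" and "1 / p + 1 / q = 1"
    and "preinvex_on \<eta> {a..a + \<eta> b a} (\<lambda>u. \<bar>f' u\<bar> powr q)"
    and "set_integrable lborel {a..a + \<eta> b a} f'"
    and "condition_C \<eta> A"
    and "x \<in> {a..a + \<eta> b a}"
  shows "\<bar>f x - 1 / \<eta> b a * (LBINT u:{a..a + \<eta> b a}. f u)\<bar>
    \<le> (1 / (p + 1)) powr (1 / p) *
      ((x - a)\<^sup>2 / \<eta> b a * ((\<bar>f' a\<bar> powr q + \<bar>f' x\<bar> powr q) / 2) powr (1 / q)
       + (a + \<eta> b a - x)\<^sup>2 / \<eta> b a *
         ((\<bar>f' (a + \<eta> b a)\<bar> powr q + \<bar>f' x\<bar> powr q) / 2) powr (1 / q))"
proof -
  define L where "L = \<eta> b a"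
  define c where "c = a + L"
  have L: "L > 0" using assms(5) by (simp add: L_def)
  have ac: "a \<le> c" "c - a = L" using L by (auto simp: c_def)
  have x: "x \<in> {a..c}" using assms by (simp add: c_def L_def)
  have p: "p > 1"
  proof -
    have "0 < 1 / q" "1 / q < 1" using assms(7) by auto
    hence p01: "0 < 1 / p" "1 / p < 1" using assms(8) by linarith+
    moreover have "0 < p" using p01 by simp
    ultimately show ?thesis by (simp add: field_simps)
  qed
  note pq = p assms(7,8)
  have f: "(f has_real_derivative f' u) (at u within {a..c})" if u: "u \<in> {a..c}" for u
  proof -
    \<comment> \<open>Invexity of \<open>A\<close>, applied to \<open>a\<close> and
      \<open>b\<close>, puts the whole segment inside \<open>A\<close>, where \<open>f\<close> is
      differentiable.\<close>
    have "(u - a) / L \<in> {0..1}" using u L ac by (auto simp: field_simps)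
    hence "a + (u - a) / L * L \<in> A"
      using assms(2-4) unfolding invex_def L_def by blast
    hence "u \<in> A" using L by simp
    thus ?thesis using assms(6) DERIV_subset by blast
  qed
  have cont: "continuous_on {a..c} f" using f by (rule DERIV_continuous_on)
  define F where "F u = integral {a..u} f" for u
  have F: "(F has_vector_derivative f u) (at u within {a..c})" if "u \<in> {a..c}" for u
    unfolding F_def by (rule integral_has_vector_derivative[OF cont that])
  hence F': "(F has_real_derivative f u) (at u within {a..c})" if "u \<in> {a..c}" for u
    using that by (simp add: has_real_derivative_iff_has_vector_derivative)
  have int: "(LBINT u:{a..c}. f u) = F c - F a"
    using integral_FTC_atLeastAtMost[OF ac(1) F cont] by (simp add: set_lebesgue_integral_def)
  \<comment> \<open>Since \<eta> is the difference on this interval, preinvexity is ordinary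
    convexity there.\<close>
  have conv: "convex_on {a..c} (\<lambda>u. \<bar>f' u\<bar> powr q)"
  proof (rule convex_onI)
    fix t y z :: real
    assume t: "0 < t" "t < 1" and yz: "y \<in> {a..c}" "z \<in> {a..c}"
    have "\<eta> z y = z - y"
      using yz unfolding c_def L_def
      by (intro condition_C_eta_diff[OF assms(2,11,3,4) L[unfolded L_def]])
    moreover have "\<bar>f' (y + t * \<eta> z y)\<bar> powr q \<le> (1 - t) * \<bar>f' y\<bar> powr q + t * \<bar>f' z\<bar> powr q"
      using assms(9) t yz unfolding preinvex_on_def c_def L_def by auto
    moreover have "(1 - t) *\<^sub>R y + t *\<^sub>R z = y + t * (z - y)"
      by (simp add: algebra_simps)
    ultimately show "\<bar>f' ((1 - t) *\<^sub>R y + t *\<^sub>R z)\<bar> powr q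
        \<le> (1 - t) * \<bar>f' y\<bar> powr q + t * \<bar>f' z\<bar> powr q"
      by simp
  qed auto
  define K where "K = (1 / (p + 1)) powr (1 / p)"
  define M where "M e = ((\<bar>f' e\<bar> powr q + \<bar>f' x\<bar> powr q) / 2) powr (1 / q)" for e
  have E: "\<bar>(x - e) * f x - (F x - F e)\<bar> \<le> (x - e)\<^sup>2 * (K * M e)" if "e \<in> {a..c}" for e
    unfolding K_def M_def by (rule endpoint_bound[OF pq _ that x f F' conv]) auto
  \<comment> \<open>Splitting \<open>L\<close> as \<open>(x - a) - (x - c)\<close> turns the
    deviation from the mean into a difference of two endpoint terms, in which \<open>F x\<close>
    cancels.\<close>
  have "f x - 1 / L * (F c - F a) = (L * f x - (F c - F a)) / L"
    using L by (simp add: field_simps)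
  also have "L * f x - (F c - F a) = ((x - a) * f x - (F x - F a)) - ((x - c) * f x - (F x - F c))"
    unfolding ac(2)[symmetric] by (simp add: algebra_simps)
  finally have "\<bar>f x - 1 / L * (F c - F a)\<bar>
      = \<bar>((x - a) * f x - (F x - F a)) - ((x - c) * f x - (F x - F c))\<bar> / L"
    using L by simp
  also have "\<dots> \<le> ((x - a)\<^sup>2 * (K * M a) + (x - c)\<^sup>2 * (K * M c)) / L"
    using E[of a] E[of c] ac(1) L by (intro divide_right_mono) auto
  also have "\<dots> = K * ((x - a)\<^sup>2 / L * M a + (c - x)\<^sup>2 / L * M c)"
    using L by (simp add: field_simps power2_commute)
  finally show ?thesis
    unfolding int[symmetric] K_def M_def by (simp add: c_def L_def)
qed

end
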